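(* Consider a helicoidal timelike surface in $\mathbf{E}_1^3$ (axis $L$, pitch $h\neq 0$) whose generating curve is the graph of a polynomial $f(s)=\sum_{n=0}^m a_n s^n$. If $H^2-K=0$ on the surface, where $H$ is the mean curvature and $K$ the Gauss curvature, then $m\le 1$. Moreover, up to a rigid motion of $\mathbf{E}_1^3$, the parametrization is: 1. If the axis is timelike, $X(s,t)=(s\cos t,\ s\sin t,\ \pm s+a_0+ht)$. In this case $a_0\in\mathbb{R}$, $|H|=1/|h|$ and $K=1/h^2$. 2. If the axis is spacelike, $X(s,t)=(ht,\ (\pm s+a_0)\sinh t+s\cosh t,\ (\pm s+a_0)\cosh t+s\sinh t)$. Here $a_0\neq0$ and $H=K=0$. 3. If the axis is lightlike, the surface is the parabolic null cylinder $X(s,t)=\big(s+bt+h(-t+\tfrac{t^3}{3}),\ b+ht^2,\ s+bt+h(t+\tfrac{t^3}{3})\big)$. Here $b\in\mathbb{R}$ and $H=K=0$.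
   Context: $\mathbf{E}_1^3$ is $\mathbb{R}^3$ with the metric $\langle(x,y,z),(x',y',z')\rangle=xx'+yy'-zz'$. A vector $v$ is spacelike if $\langle v,v\rangle>0$ or $v=0$, timelike if $\langle v,v\rangle<0$, lightlike if $\langle v,v\rangle=0$, $v\ne0$; a line is called timelike, spacelike or lightlike according to its direction vector. Rigid motions are isometries of $\mathbf{E}_1^3$. Helicoidal motions. A helicoidal motion group $G_{L,h}=\{\phi_t : t\in\mathbb{R}\}$ with axis $L$ and pitch $h\neq0$ is, after a change of coordinates by a rigid motion, one of the following, and coordinates are always chosen so: - $L=\langle(0,0,1)\rangle$ timelike: $\phi_t(a,b,c)=(a\cos t-b\sin t,\ a\sin t+b\cos t,\ c+ht)$. - $L=\langle(1,0,0)\rangle$ spacelike: $\phi_t(a,b,c)=(a+ht,\ b\cosh t+c\sinh t,\ b\sinh t+c\cosh t)$. - $L=\langle(1,0,1)\rangle$ lightlike: $\phi_t(a,b,c)=\big((1-\tfrac{t^2}{2})a+tb+\tfrac{t^2}{2}c,\ -ta+b+tc,\ -\tfrac{t^2}{2}a+tb+(1+\tfrac{t^2}{2})c\big)+h\big(\tfrac{t^3}{3}-t,\ t^2,\ \tfrac{t^3}{3}+t\big)$. Helicoidal surface and generating curve. A helicoidal surface is one invariant under some $G_{L,h}$, $h\ne0$; it is parametrized by $X(s,t)=\phi_t(\gamma(s))$, $s\in I$ (an open interval), $t\in\mathbb{R}$, where the generating curve $\gamma$ is a planar curve contained in the plane $y=0$ (timelike axis), $x=0$ (spacelike axis), $x=z$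 (lightlike axis). "$\gamma$ is the graph of a polynomial $f$" means: $\gamma(s)=(s,0,f(s))$ (timelike axis), $\gamma(s)=(0,s,f(s))$ (spacelike axis), $\gamma(s)=(f(s),s,f(s))$ (lightlike axis), with $a_m\neq 0$ if $m\ge1$. The straight lines that are not graphs of this form, namely $\gamma(s)=(r,0,s)$ with $r>0$, $\gamma(s)=(0,b,s)$, $\gamma(s)=(s,b,s)$ respectively, are also admitted (and counted as degree $\le 1$). Surfaces are identified locally: "the surface is $S$" means it is an open part of $S$. Curvature. A surface is timelike if its induced metric is everywhere Lorentzian (non-degenerate of index 1). Let $N$ be a (local) unit normal, so $\langle N,N\rangle=1$, and $A=-dN$. Then $H=\frac12\operatorname{trace}(A)$ and $K=\det(A)$. *)

theory Defs
  imports "HOL-Analysis.Analysis" "HOL-Computational_Algebra.Polynomial"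
begin

definition lorentz :: "real^3 \<Rightarrow> real^3 \<Rightarrow> real" where
  "lorentz u v = u$1 * v$1 + u$2 * v$2 - u$3 * v$3"

definition rigid_motion :: "(real^3 \<Rightarrow> real^3) \<Rightarrow> bool" where
  "rigid_motion \<Psi> \<longleftrightarrow>
     (\<exists>L w. linear L \<and> (\<forall>u v. lorentz (L u) (L v) = lorentz u v) \<and> \<Psi> = (\<lambda>p. L p + w))"

text \<open>
  The three normal forms of the axis:
  \<open>(0,0,1)\<close>, \<open>(1,0,0)\<close> and \<open>(1,0,1)\<close>.
\<close>

datatype axis = Timelike_axis | Spacelike_axis | Lightlike_axis

fun helicoidal_motion :: "axis \<Rightarrow> real \<Rightarrow> real \<Rightarrow> real^3 \<Rightarrow> real^3" where
  "helicoidal_motion Timelike_axis h t p =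
     vector [p$1 * cos t - p$2 * sin t, p$1 * sin t + p$2 * cos t, p$3 + h * t]"
| "helicoidal_motion Spacelike_axis h t p =
     vector [p$1 + h * t, p$2 * cosh t + p$3 * sinh t, p$2 * sinh t + p$3 * cosh t]"
| "helicoidal_motion Lightlike_axis h t p =
     vector [(1 - t^2/2) * p$1 + t * p$2 + t^2/2 * p$3,
             - t * p$1 + p$2 + t * p$3,
             - (t^2/2) * p$1 + t * p$2 + (1 + t^2/2) * p$3]
     + h *\<^sub>R vector [t^3/3 - t, t^2, t^3/3 + t]"

text \<open>
  \<open>Graph f\<close> is the graph of a polynomial; \<open>Line r\<close> is one of the
  straight lines of the generating plane that is not such a graph.
\<close>

datatype profile = Graph "real poly" | Line real

fun generating_curve :: "axis \<Rightarrow> profile \<Rightarrow> real \<Rightarrow> real^3" where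
  "generating_curve Timelike_axis (Graph f) s = vector [s, 0, poly f s]"
| "generating_curve Spacelike_axis (Graph f) s = vector [0, s, poly f s]"
| "generating_curve Lightlike_axis (Graph f) s = vector [poly f s, s, poly f s]"
| "generating_curve Timelike_axis (Line r) s = vector [r, 0, s]"
| "generating_curve Spacelike_axis (Line b) s = vector [0, b, s]"
| "generating_curve Lightlike_axis (Line b) s = vector [s, b, s]"

fun admissible_profile :: "axis \<Rightarrow> profile \<Rightarrow> bool" where
  "admissible_profile Timelike_axis (Line r) \<longleftrightarrow> r > 0"
| "admissible_profile _ _ \<longleftrightarrow> True"

text \<open>By convention a straight line has degree 1 even when it is not a graph.\<close>

fun profile_degree :: "profile \<Rightarrow> nat" where
  "profile_degree (Graph f) = degree f"
| "profile_degree (Line r) = 1"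

definition partial_s :: "(real \<Rightarrow> real \<Rightarrow> real^3) \<Rightarrow> real \<Rightarrow> real \<Rightarrow> real^3" where
  "partial_s F s t = vector_derivative (\<lambda>x. F x t) (at s)"

definition partial_t :: "(real \<Rightarrow> real \<Rightarrow> real^3) \<Rightarrow> real \<Rightarrow> real \<Rightarrow> real^3" where
  "partial_t F s t = vector_derivative (\<lambda>y. F s y) (at t)"

definition tangent_plane :: "(real \<Rightarrow> real \<Rightarrow> real^3) \<Rightarrow> real \<Rightarrow> real \<Rightarrow> (real^3) set" where
  "tangent_plane X s t = span {partial_s X s t, partial_t X s t}"

definition nondegenerate_on :: "(real^3) set \<Rightarrow> bool" where
  "nondegenerate_on T \<longleftrightarrow> (\<forall>u\<in>T. (\<forall>v\<in>T. lorentz u v = 0) \<longrightarrow> u = 0)"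

definition metric_index :: "(real^3) set \<Rightarrow> nat" where
  "metric_index T =
     Max {dim V | V. subspace V \<and> V \<subseteq> T \<and> (\<forall>v\<in>V. v \<noteq> 0 \<longrightarrow> lorentz v v < 0)}"

definition timelike_surface :: "(real \<Rightarrow> real \<Rightarrow> real^3) \<Rightarrow> (real \<times> real) set \<Rightarrow> bool" where
  "timelike_surface X U \<longleftrightarrow>
     (\<forall>(s, t)\<in>U. dim (tangent_plane X s t) = 2 \<and>
        nondegenerate_on (tangent_plane X s t) \<and> metric_index (tangent_plane X s t) = 1)"

definition unit_normal_field ::
  "(real \<Rightarrow> real \<Rightarrow> real^3) \<Rightarrow> (real \<times> real) set \<Rightarrow> (real \<Rightarrow> real \<Rightarrow> real^3) \<Rightarrow> bool" where
  "unit_normal_field X U N \<longleftrightarrow>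
     (\<lambda>(s, t). N s t) differentiable_on U \<and>
     (\<forall>(s, t)\<in>U. lorentz (N s t) (N s t) = 1 \<and>
        (\<forall>v\<in>tangent_plane X s t. lorentz (N s t) v = 0))"

text \<open>
  The matrix of \<open>A = -dN\<close> in the basis \<open>(X\<^sub>s, X\<^sub>t)\<close> of the tangent plane;
  its columns are the coordinates of \<open>A X\<^sub>s = -N\<^sub>s\<close> and \<open>A X\<^sub>t = -N\<^sub>t\<close>.
  It exists and is unique for a unit normal field of a timelike surface.
\<close>

definition shape_matrix ::
  "(real \<Rightarrow> real \<Rightarrow> real^3) \<Rightarrow> (real \<Rightarrow> real \<Rightarrow> real^3) \<Rightarrow> real \<Rightarrow> real \<Rightarrow> real^2^2" where
  "shape_matrix X N s t = (THE A.
     - partial_s N s t = A$1$1 *\<^sub>R partial_s X s t + A$2$1 *\<^sub>R partial_t X s t \<and>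
     - partial_t N s t = A$1$2 *\<^sub>R partial_s X s t + A$2$2 *\<^sub>R partial_t X s t)"

definition mean_curvature ::
  "(real \<Rightarrow> real \<Rightarrow> real^3) \<Rightarrow> (real \<Rightarrow> real \<Rightarrow> real^3) \<Rightarrow> real \<Rightarrow> real \<Rightarrow> real" where
  "mean_curvature X N s t = trace (shape_matrix X N s t) / 2"

definition gauss_curvature ::
  "(real \<Rightarrow> real \<Rightarrow> real^3) \<Rightarrow> (real \<Rightarrow> real \<Rightarrow> real^3) \<Rightarrow> real \<Rightarrow> real \<Rightarrow> real" where
  "gauss_curvature X N s t = det (shape_matrix X N s t)"

end

theory Submission
  imports Defs
begin

text \<open>
  Umbilicity \<open>H\<^sup>2 = K\<close> is a condition at each point, and a helicoidal surface is homogeneous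
  along its orbits, so the condition is an ordinary differential equation for the generating curve;
  the point is that the polynomial solutions of this equation can be read off from degrees.

  Let \<open>\<Phi>\<^sub>t\<close> be the linear part of the motion \<open>\<phi>\<^sub>t\<close> and let \<open>V\<close> be the Killing field
  generating the group. Then \<open>X = \<Psi> (\<phi>\<^sub>t (\<gamma> s))\<close> satisfies \<open>X\<^sub>s = L \<Phi>\<^sub>t \<gamma>'\<close> and
  \<open>X\<^sub>t = L \<Phi>\<^sub>t (V \<gamma>)\<close>, where \<open>L\<close> is the linear part of \<open>\<Psi>\<close>, and the second derivatives have the
  same form. Since \<open>L \<Phi>\<^sub>t\<close> preserves the metric, it drops out of all fundamental forms: with
  \<open>a = \<gamma>'\<close>, \<open>b = V \<gamma>\<close>, the unit normal is \<open>L \<Phi>\<^sub>t\<close> applied to a multiple of the Lorentzian cross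
  product of \<open>a\<close> and \<open>b\<close>. Differentiating \<open>\<langle>N, X\<^sub>s\<rangle> = \<langle>N, X\<^sub>t\<rangle> = 0\<close> gives the shape operator, and
  with \<open>D = E G - F\<^sup>2\<close>, \<open>P = E n - 2 F m + G l\<close>, \<open>Q = l n - m\<^sup>2\<close> (the coefficients \<open>l, m, n\<close> being
  formed with the unnormalised normal) umbilicity becomes
  \<open>P\<^sup>2 = 4 D Q\<close>, while \<open>K = - Q / D\<^sup>2\<close> (lemma \<open>umbilic_helicoidal_equations\<close>).

  For the graph of a polynomial \<open>f\<close> the equation \<open>P\<^sup>2 = 4 D Q\<close> is a polynomial identity in
  \<open>s, f, f', f''\<close>. It holds on an interval, hence identically. If \<open>f\<close> had degree \<open>m \<ge> 2\<close>, the
  two sides would have different degrees: for a timelike axis \<open>6 m - 2\<close> against at most \<open>4 m\<close>, for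
  a spacelike axis at most \<open>6 m - 4\<close> against \<open>8 m - 6\<close>, for a lightlike axis at most
  \<open>2 m - 2\<close> against \<open>4 m - 5\<close>.
  So \<open>f\<close> is affine, and the remaining identity forces the slope to be \<open>\<plusminus>1\<close> for the first
  two axes and is unsolvable for the lightlike one. Of the straight lines that are not graphs, only
  the lightlike line in the plane of a lightlike axis satisfies the equation; it
  generates the parabolic null cylinder. The values of \<open>H\<close> and \<open>K\<close> then follow from
  \<open>K = - Q / D\<^sup>2\<close> and \<open>H\<^sup>2 = K\<close>.
\<close>

section \<open>Planes in Lorentz-Minkowski space and the Weingarten equations\<close>

text \<open>
  The sign of the third coordinate makes \<open>lorentz (lorentz_cross a b) c\<close> the determinant of the
  columns \<open>a\<close>, \<open>b\<close>, \<open>c\<close>; in particular the product is normal to \<open>a\<close> and \<open>b\<close> for the Lorentzian metric.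
\<close>

definition lorentz_cross :: "real^3 \<Rightarrow> real^3 \<Rightarrow> real^3" where
  "lorentz_cross a b = vector [a$2 * b$3 - a$3 * b$2, a$3 * b$1 - a$1 * b$3, a$2 * b$1 - a$1 * b$2]"

text \<open>
  The discriminant \<open>E G - F\<^sup>2\<close> of the first fundamental form.
\<close>

definition gram_det :: "real^3 \<Rightarrow> real^3 \<Rightarrow> real" where
  "gram_det a b = lorentz a a * lorentz b b - (lorentz a b)^2"

lemma bilinear_lorentz: "bilinear lorentz"
  by (auto simp: bilinear_def lorentz_def algebra_simps intro!: linearI)

lemma bounded_bilinear_lorentz: "bounded_bilinear lorentz"
  using bilinear_lorentz by (simp add: bilinear_conv_bounded_bilinear)

lemmas lorentz_simps =
  bilinear_ladd[OF bilinear_lorentz] bilinear_radd[OF bilinear_lorentz]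
  bilinear_lsub[OF bilinear_lorentz] bilinear_rsub[OF bilinear_lorentz]
  bilinear_lneg[OF bilinear_lorentz] bilinear_rneg[OF bilinear_lorentz]
  bilinear_lmul[OF bilinear_lorentz] bilinear_rmul[OF bilinear_lorentz]
  bilinear_lzero[OF bilinear_lorentz] bilinear_rzero[OF bilinear_lorentz]

lemma lorentz_commute: "lorentz u v = lorentz v u"
  by (simp add: lorentz_def mult.commute)

lemma lorentz_nondegenerate:
  assumes "\<And>v. lorentz u v = 0"
  shows "u = 0"
proof -
  have "u$1 = 0" "u$2 = 0" "u$3 = 0"
    using assms[of "axis 1 1"] assms[of "axis 2 1"] assms[of "axis 3 1"]
    by (simp_all add: lorentz_def axis_def)
  then show ?thesis
    by (simp add: vec_eq_iff forall_3)
qed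

lemma lorentz_cross_self: "lorentz (lorentz_cross a b) (lorentz_cross a b) = - gram_det a b"
  unfolding lorentz_def lorentz_cross_def gram_det_def vector_3 by algebra

text \<open>
  The coordinates of a vector in the basis \<open>a\<close>, \<open>b\<close>, \<open>lorentz_cross a b\<close>, cleared of denominators:
  the tangential part is Cramer's rule for the Gram matrix, and the minus sign of the normal part comes
  from \<open>lorentz_cross_self\<close>. This one identity
  gives both the direction of the normal and the Weingarten coefficients.
\<close>

lemma gram_det_decomposition:
  "gram_det a b *\<^sub>R v =
     (lorentz v a * lorentz b b - lorentz v b * lorentz a b) *\<^sub>R a
   + (lorentz v b * lorentz a a - lorentz v a * lorentz a b) *\<^sub>R b
   - lorentz v (lorentz_cross a b) *\<^sub>R lorentz_cross a b"
  unfolding vec_eq_iff forall_3 lorentz_def lorentz_cross_def gram_det_def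
    vector_add_component vector_minus_component vector_scaleR_component vector_3 real_scaleR_def
  by (intro conjI; algebra)

text \<open>
  If the Gram determinant vanished, the rows of the adjugate Gram matrix would be the coordinates of
  vectors orthogonal to the whole plane, so nondegeneracy would make the Gram matrix itself zero,
  and then the metric would vanish on the plane.
\<close>

lemma gram_det_nonzero:
  assumes dim: "dim (span {a, b}) = 2" and nd: "nondegenerate_on (span {a, b})"
  shows "gram_det a b \<noteq> 0"
proof
  assume D: "gram_det a b = 0"
  have a: "a \<notin> span {b}" and b: "b \<noteq> 0"
    using dim by (auto simp: dim_insert split: if_splits)
  have indep: "x = 0 \<and> y = 0" if "x *\<^sub>R a + y *\<^sub>R b = 0" for x y
  proof -
    have "x = 0"
    proof (rule ccontr)
      assume "x \<noteq> 0"
      have "x *\<^sub>R a = (- y) *\<^sub>R b"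
        using that by (simp add: add_eq_0_iff2)
      then have "a = (1 / x) *\<^sub>R ((- y) *\<^sub>R b)"
        using \<open>x \<noteq> 0\<close> by (metis divide_self_if scaleR_one scaleR_scaleR times_divide_eq_left mult_1)
      then show False
        using a by (metis span_base span_mul singletonI)
    qed
    then show ?thesis using that b by simp
  qed
  have null: "u = 0" if "u \<in> span {a, b}" "lorentz u a = 0" "lorentz u b = 0" for u
  proof -
    have "lorentz u v = 0" if "v \<in> span {a, b}" for v
      using that \<open>lorentz u a = 0\<close> \<open>lorentz u b = 0\<close>
      by (induction rule: span_induct_alt) (auto simp: lorentz_simps)
    then show ?thesis using nd that(1) by (auto simp: nondegenerate_on_def)
  qed
  let ?E = "lorentz a a" and ?F = "lorentz a b" and ?G = "lorentz b b"
  have ins: "x *\<^sub>R a + y *\<^sub>R b \<in> span {a, b}" for x y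
    by (intro span_add span_mul span_base) auto
  have "?G *\<^sub>R a + (- ?F) *\<^sub>R b = 0" "(- ?F) *\<^sub>R a + ?E *\<^sub>R b = 0"
    using D by (intro null ins; simp add: lorentz_simps lorentz_commute[of b a] gram_det_def
        power2_eq_square mult.commute)+
  then have "?E = 0" "?F = 0" using indep by fastforce+
  then have "a = 0"
    by (intro null span_base) (auto)
  then show False using a by (simp add: span_zero)
qed

text \<open>
  In the next two definitions \<open>a, b\<close> stand for \<open>X\<^sub>s, X\<^sub>t\<close> and \<open>u, v, w\<close> for
  \<open>X\<^sub>s\<^sub>s, X\<^sub>s\<^sub>t, X\<^sub>t\<^sub>t\<close>. The values are \<open>E n - 2 F m + G l\<close> and \<open>l n - m\<^sup>2\<close>, where the second fundamental
  form is taken with respect to the normal \<open>lorentz_cross a b\<close> without normalisation; this keeps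
  them polynomial.
\<close>

definition mean_numerator :: "real^3 \<Rightarrow> real^3 \<Rightarrow> real^3 \<Rightarrow> real^3 \<Rightarrow> real^3 \<Rightarrow> real" where
  "mean_numerator a b u v w =
     lorentz a a * lorentz (lorentz_cross a b) w - 2 * lorentz a b * lorentz (lorentz_cross a b) v
     + lorentz b b * lorentz (lorentz_cross a b) u"

definition gauss_numerator :: "real^3 \<Rightarrow> real^3 \<Rightarrow> real^3 \<Rightarrow> real^3 \<Rightarrow> real^3 \<Rightarrow> real" where
  "gauss_numerator a b u v w =
     lorentz (lorentz_cross a b) u * lorentz (lorentz_cross a b) w - (lorentz (lorentz_cross a b) v)^2"

definition lorentz_isometry :: "(real^3 \<Rightarrow> real^3) \<Rightarrow> bool" where
  "lorentz_isometry R \<longleftrightarrow> linear R \<and> (\<forall>u v. lorentz (R u) (R v) = lorentz u v)"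

lemma lorentz_isometry_bij:
  assumes "lorentz_isometry R"
  shows "bij R"
proof -
  have lin: "linear R" and iso: "\<And>u v. lorentz (R u) (R v) = lorentz u v"
    using assms by (auto simp: lorentz_isometry_def)
  have "inj R"
    unfolding linear_injective_0[OF lin]
  proof (intro allI impI)
    fix x assume "R x = 0"
    then have "lorentz x y = 0" for y
      using iso[of x y] by (simp add: lorentz_simps)
    then show "x = 0" by (rule lorentz_nondegenerate)
  qed
  then show ?thesis
    using linear_injective_imp_surjective[OF lin] by (auto simp: bij_def)
qed

text \<open>
  The Weingarten equations at a point. Here \<open>n\<close> is the unit normal, \<open>p\<close> and \<open>q\<close> are its two partial
  derivatives, and \<open>\<mu>\<close> is the factor with \<open>n = \<mu> *\<^sub>R lorentz_cross a b\<close>. The vectors \<open>p\<close>, \<open>q\<close> are tangent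
  because they are orthogonal to \<open>n\<close>, so their coordinates are determined by their products
  with \<open>a\<close> and \<open>b\<close>.
\<close>

lemma weingarten_pointwise:
  fixes a b u v w n p q :: "real^3" 
  assumes D: "gram_det a b \<noteq> 0"
    and n: "lorentz n n = 1" "lorentz n a = 0" "lorentz n b = 0"
    and p: "lorentz p n = 0" "lorentz p a = - lorentz n u" "lorentz p b = - lorentz n v"
    and q: "lorentz q n = 0" "lorentz q a = - lorentz n v" "lorentz q b = - lorentz n w"
  obtains \<mu> A where "\<mu>^2 * gram_det a b = - 1"
    "\<And>B. (- p = B$1$1 *\<^sub>R a + B$2$1 *\<^sub>R b \<and> - q = B$1$2 *\<^sub>R a + B$2$2 *\<^sub>R b) \<longleftrightarrow> B = (A::real^2^2)"
    "trace A = \<mu> * mean_numerator a b u v w / gram_det a b"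
    "det A = \<mu>^2 * gauss_numerator a b u v w / gram_det a b"
proof -
  define \<nu> where "\<nu> = lorentz_cross a b"
  define d where "d = gram_det a b"
  define \<mu> where "\<mu> = - lorentz n \<nu> / d"
  have d: "d \<noteq> 0" using D by (simp add: d_def)
  have "d *\<^sub>R n = (- lorentz n \<nu>) *\<^sub>R \<nu>"
    using gram_det_decomposition[of a b n] n by (simp add: \<nu>_def d_def)
  then have n_eq: "n = \<mu> *\<^sub>R \<nu>"
    using d by (metis \<mu>_def divide_inverse_commute scaleR_scaleR scaleR_one left_inverse)
  have \<mu>: "\<mu>^2 * d = -1"
    using n(1) lorentz_cross_self[of a b] by (simp add: n_eq lorentz_simps power2_eq_square \<nu>_def d_def)
  then have \<mu>0: "\<mu> \<noteq> 0" by auto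
  have nu_orth: "lorentz x \<nu> = 0" if "lorentz x n = 0" for x
    using that \<mu>0 by (simp add: n_eq lorentz_simps)
  let ?E = "lorentz a a" and ?F = "lorentz a b" and ?G = "lorentz b b"
  \<comment> \<open>a tangent vector is the solution of the linear system with the Gram matrix\<close>
  have coords: "- x = y *\<^sub>R a + z *\<^sub>R b \<longleftrightarrow>
      y = (- lorentz x a * ?G + lorentz x b * ?F) / d \<and> z = (- lorentz x b * ?E + lorentz x a * ?F) / d"
    if x: "lorentz x n = 0" for x y z
  proof
    assume "- x = y *\<^sub>R a + z *\<^sub>R b"
    then have eq: "x = - (y *\<^sub>R a + z *\<^sub>R b)" by (metis minus_minus)
    have "lorentz x a = - (y * ?E + z * ?F)" "lorentz x b = - (y * ?F + z * ?G)"
      unfolding eq by (simp_all add: lorentz_simps lorentz_commute[of b a])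
    then show "y = (- lorentz x a * ?G + lorentz x b * ?F) / d \<and> z = (- lorentz x b * ?E + lorentz x a * ?F) / d"
      using d by (simp add: eq_divide_eq) (simp add: d_def gram_det_def power2_eq_square algebra_simps)
  next
    assume yz: "y = (- lorentz x a * ?G + lorentz x b * ?F) / d \<and> z = (- lorentz x b * ?E + lorentz x a * ?F) / d"
    have "lorentz x a * ?G - lorentz x b * ?F = - (d * y)" "lorentz x b * ?E - lorentz x a * ?F = - (d * z)"
      using yz d by simp_all
    then have "d *\<^sub>R x = (- (d * y)) *\<^sub>R a + (- (d * z)) *\<^sub>R b"
      using gram_det_decomposition[of a b x] nu_orth[OF x]
      by (simp only: \<nu>_def[symmetric] d_def[symmetric] scaleR_zero_left diff_zero)
    then have "d *\<^sub>R (- x) = d *\<^sub>R (y *\<^sub>R a + z *\<^sub>R b)"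
      by (simp add: scaleR_add_right)
    then show "- x = y *\<^sub>R a + z *\<^sub>R b"
      using d by (rule scaleR_left_imp_eq[rotated])
  qed
  define L where "L = lorentz n u"
  define M where "M = lorentz n v"
  define W where "W = lorentz n w"
  define A :: "real^2^2" where "A = vector [vector [(L * ?G - M * ?F) / d, (M * ?G - W * ?F) / d],
      vector [(M * ?E - L * ?F) / d, (W * ?E - M * ?F) / d]]"
  have LMW: "L = \<mu> * lorentz \<nu> u" "M = \<mu> * lorentz \<nu> v" "W = \<mu> * lorentz \<nu> w"
    by (simp_all add: L_def M_def W_def n_eq lorentz_simps)
  have 1: "(- p = B$1$1 *\<^sub>R a + B$2$1 *\<^sub>R b \<and> - q = B$1$2 *\<^sub>R a + B$2$2 *\<^sub>R b) \<longleftrightarrow> B = A" for B :: "real^2^2"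
    unfolding coords[OF p(1)] coords[OF q(1)] 
    by (auto simp: vec_eq_iff forall_2 A_def p q L_def M_def W_def)
  have 2: "trace A = \<mu> * mean_numerator a b u v w / d"
    using d by (simp add: trace_def sum_2 A_def LMW mean_numerator_def \<nu>_def field_simps)
  have "det A = (L * W - M^2) * d / d^2"
    using d by (simp add: det_2 A_def field_simps power2_eq_square)
      (simp add: d_def gram_det_def power2_eq_square algebra_simps)
  then have "det A = (L * W - M^2) / d"
    using d by (simp add: power2_eq_square)
  then have 3: "det A = \<mu>^2 * gauss_numerator a b u v w / d"
    by (simp add: LMW gauss_numerator_def \<nu>_def power2_eq_square algebra_simps)
  show thesis
    using that[of \<mu> A] \<mu> 1 2 3 by (simp add: d_def)
qed

section \<open>Curvatures of a helicoidal surface from its generating curve\<close>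

lemma has_vector_derivative_vector3:
  assumes "(x has_real_derivative x') (at t)" "(y has_real_derivative y') (at t)"
    "(z has_real_derivative z') (at t)"
  shows "((\<lambda>t. vector [x t, y t, z t] :: real^3) has_vector_derivative vector [x', y', z']) (at t)"
proof -
  have eq: "(vector [a, b, c] :: real^3) = a *\<^sub>R axis 1 1 + b *\<^sub>R axis 2 1 + c *\<^sub>R axis 3 1" for a b c :: real
    by (simp add: vec_eq_iff forall_3 vector_3 axis_def)
  show ?thesis
    unfolding eq using assms
    by (auto intro!: derivative_eq_intros simp: has_real_derivative_iff_has_vector_derivative)
qed

text \<open>
  The velocity field \<open>p \<mapsto> d/dt \<phi>\<^sub>t(p)\<close> at \<open>t = 0\<close>. It is affine in \<open>p\<close> with linear part
  \<open>killing_field ax 0\<close>; likewise \<open>helicoidal_motion ax 0 t\<close> is the linear part of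
  \<open>helicoidal_motion ax h t\<close>.
\<close>

fun killing_field :: "axis \<Rightarrow> real \<Rightarrow> real^3 \<Rightarrow> real^3" where
  "killing_field Timelike_axis h p = vector [- p$2, p$1, h]"
| "killing_field Spacelike_axis h p = vector [h, p$3, p$2]"
| "killing_field Lightlike_axis h p = vector [p$2 - h, p$3 - p$1, p$2 + h]"

lemma killing_field_split: "killing_field ax h p = killing_field ax 0 p + killing_field ax h 0"
  by (cases ax) (simp_all add: vec_eq_iff forall_3 vector_3)

lemma linear_killing_field: "linear (killing_field ax 0)"
  by (cases ax; intro linearI) (simp_all add: vec_eq_iff forall_3 vector_3 algebra_simps)

lemma helicoidal_motion_split:
  "helicoidal_motion ax h t p = helicoidal_motion ax 0 t p + helicoidal_motion ax h t 0"
  by (cases ax) (simp_all add: vec_eq_iff forall_3 vector_3)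

lemma linear_helicoidal_motion: "linear (helicoidal_motion ax 0 t)"
  by (cases ax; intro linearI) (simp_all add: vec_eq_iff forall_3 vector_3 algebra_simps)

lemma lorentz_isometry_helicoidal_motion: "lorentz_isometry (helicoidal_motion ax 0 t)"
proof -
  have "lorentz (helicoidal_motion ax 0 t u) (helicoidal_motion ax 0 t v) = lorentz u v" for u v
  proof (cases ax)
    case Timelike_axis
    have "cos t ^ 2 + sin t ^ 2 = 1" by simp
    then show ?thesis unfolding Timelike_axis helicoidal_motion.simps lorentz_def vector_3 by algebra
  next
    case Spacelike_axis
    have "cosh t ^ 2 - sinh t ^ 2 = 1" by (rule hyperbolic_pythagoras)
    then show ?thesis unfolding Spacelike_axis helicoidal_motion.simps lorentz_def vector_3 by algebra
  next
    case Lightlike_axis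
    \<comment> \<open>a name for \<open>t\<^sup>2/2\<close> makes the isometry condition polynomial\<close>
    define r where "r = t^2 / 2"
    have r: "2 * r = t^2" by (simp add: r_def)
    show ?thesis unfolding Lightlike_axis helicoidal_motion.simps lorentz_def vector_3
        vector_add_component scaleR_zero_left zero_index add_0_right r_def[symmetric]
      using r by algebra
  qed
  then show ?thesis
    by (simp add: lorentz_isometry_def linear_helicoidal_motion)
qed

text \<open>
  Infinitesimal form of the group law \<open>\<phi>\<^bsub>t+r\<^esub> = \<phi>\<^sub>t \<circ> \<phi>\<^sub>r\<close>. With \<open>h = 0\<close> it also differentiates the
  linear parts.
\<close>

lemma helicoidal_motion_derivative:
  "((\<lambda>t. helicoidal_motion ax h t p) has_vector_derivative
      helicoidal_motion ax 0 t (killing_field ax h p)) (at t)"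
proof (cases ax)
  case Timelike_axis
  show ?thesis unfolding Timelike_axis helicoidal_motion.simps killing_field.simps vector_3
    by (rule has_vector_derivative_vector3) (auto intro!: derivative_eq_intros)
next
  case Spacelike_axis
  show ?thesis unfolding Spacelike_axis helicoidal_motion.simps killing_field.simps vector_3
    by (rule has_vector_derivative_vector3) (auto intro!: derivative_eq_intros)
next
  case Lightlike_axis
  have eq: "(\<lambda>t. helicoidal_motion ax h t p) = (\<lambda>t. vector
     [(1 - t^2/2) * p$1 + t * p$2 + t^2/2 * p$3 + h * (t^3/3 - t), 
      - t * p$1 + p$2 + t * p$3 + h * t^2,
      - (t^2/2) * p$1 + t * p$2 + (1 + t^2/2) * p$3 + h * (t^3/3 + t)])"
    by (simp add: Lightlike_axis fun_eq_iff vec_eq_iff forall_3 vector_3)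
  have eq': "helicoidal_motion ax 0 t (killing_field ax h p) = vector
     [- t * p$1 + p$2 + t * p$3 + h * (t^2 - 1), - p$1 + p$3 + h * (2 * t),
      - t * p$1 + p$2 + t * p$3 + h * (t^2 + 1)]"
    by (simp add: Lightlike_axis vec_eq_iff forall_3 vector_3 field_simps)
  show ?thesis unfolding eq eq'
    by (rule has_vector_derivative_vector3) (auto intro!: derivative_eq_intros simp: field_simps)
qed

lemma lorentz_product_rule_constant:
  assumes "(f has_vector_derivative f') (at x)" "(g has_vector_derivative g') (at x)"
    and "open S" "x \<in> S" "\<And>y. y \<in> S \<Longrightarrow> lorentz (f y) (g y) = c"
  shows "lorentz f' (g x) = - lorentz (f x) g'"
proof -
  have "((\<lambda>y. lorentz (f y) (g y)) has_vector_derivative lorentz (f x) g' + lorentz f' (g x)) (at x)"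
    using assms bounded_bilinear.has_vector_derivative[OF bounded_bilinear_lorentz] by blast
  moreover have "((\<lambda>y. lorentz (f y) (g y)) has_vector_derivative 0) (at x)"
    by (rule has_vector_derivative_transform_within_open[OF has_vector_derivative_const]) (use assms in auto)
  ultimately show ?thesis
    using vector_derivative_unique_at by fastforce
qed

text \<open>
  The ambient isometry \<open>R t\<close>, composed of the linear parts of \<open>\<Psi>\<close> and of the motion, carries
  the data \<open>\<gamma>'\<close>, \<open>V \<gamma>\<close>, \<open>\<gamma>''\<close>, \<open>V\<^sub>0 \<gamma>'\<close>, \<open>V\<^sub>0 (V \<gamma>)\<close> (with \<open>V\<^sub>0\<close> the linear part of \<open>V\<close>) to
  \<open>X\<^sub>s, X\<^sub>t, X\<^sub>s\<^sub>s, X\<^sub>s\<^sub>t, X\<^sub>t\<^sub>t\<close>. Pulling the normal and its derivatives back along \<open>R t\<close>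
  therefore expresses the curvatures by the generating curve alone.
\<close>

lemma helicoidal_curvatures:
  fixes \<gamma> \<gamma>' \<gamma>'' :: "real \<Rightarrow> real^3"
  assumes I: "open I"
    and \<gamma>: "\<And>s. s \<in> I \<Longrightarrow> (\<gamma> has_vector_derivative \<gamma>' s) (at s)"
    and \<gamma>': "\<And>s. s \<in> I \<Longrightarrow> (\<gamma>' has_vector_derivative \<gamma>'' s) (at s)"
    and \<Psi>: "rigid_motion \<Psi>"
    and X: "\<forall>s\<in>I. \<forall>t. X s t = \<Psi> (helicoidal_motion ax h t (\<gamma> s))"
    and timelike: "timelike_surface X (I \<times> UNIV)"
    and N: "unit_normal_field X (I \<times> UNIV) N"
    and s: "s \<in> I"
  defines "a \<equiv> \<gamma>' s" and "b \<equiv> killing_field ax h (\<gamma> s)"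
  defines "u \<equiv> \<gamma>'' s" and "v \<equiv> killing_field ax 0 a" and "w \<equiv> killing_field ax 0 b"
  obtains \<mu> where "\<mu>^2 * gram_det a b = - 1"
    "mean_curvature X N s t = \<mu> * mean_numerator a b u v w / (2 * gram_det a b)"
    "gauss_curvature X N s t = \<mu>^2 * gauss_numerator a b u v w / gram_det a b"
proof -
  obtain L z where L: "lorentz_isometry L" and \<Psi>_eq: "\<Psi> = (\<lambda>p. L p + z)"
    using \<Psi> by (auto simp: rigid_motion_def lorentz_isometry_def)
  have linL: "linear L" using L by (simp add: lorentz_isometry_def)
  have L_deriv: "((\<lambda>x. L (f x)) has_vector_derivative L f') F" if "(f has_vector_derivative f') F" for f f' F
    by (rule bounded_linear.has_vector_derivative[OF linL[unfolded linear_conv_bounded_linear] that])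
  define R where "R = (\<lambda>t p. L (helicoidal_motion ax 0 t p))"
  have R: "lorentz_isometry (R t)" for t
    using L lorentz_isometry_helicoidal_motion[of ax t] linear_compose[of "helicoidal_motion ax 0 t" L]
    by (simp add: lorentz_isometry_def R_def o_def)
  then have linR: "linear (R t)" and isoR: "lorentz (R t p) (R t q) = lorentz p q" for t p q
    by (simp_all add: lorentz_isometry_def)
  have R_deriv: "((\<lambda>x. R t (f x)) has_vector_derivative R t f') F" if "(f has_vector_derivative f') F" for f f' F t
    by (rule bounded_linear.has_vector_derivative[OF linR[unfolded linear_conv_bounded_linear] that])
  have R_deriv_t: "((\<lambda>t. R t p) has_vector_derivative R t (killing_field ax 0 p)) (at t)" for t p
    unfolding R_def by (rule L_deriv, rule helicoidal_motion_derivative)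
  have X_s: "partial_s X s t = R t (\<gamma>' s)" if s: "s \<in> I" for s t
    unfolding partial_s_def
  proof (rule vector_derivative_at, rule has_vector_derivative_transform_within_open[OF _ I s])
    show "((\<lambda>x. R t (\<gamma> x) + (L (helicoidal_motion ax h t 0) + z)) has_vector_derivative R t (\<gamma>' s)) (at s)"
      unfolding has_vector_derivative_add_const by (rule R_deriv[OF \<gamma>[OF s]])
  next
    fix y assume "y \<in> I"
    then show "R t (\<gamma> y) + (L (helicoidal_motion ax h t 0) + z) = X y t"
      using X by (simp, subst helicoidal_motion_split) (simp add: \<Psi>_eq R_def linear_add[OF linL])
  qed
  have X_t: "partial_t X s t = R t (killing_field ax h (\<gamma> s))" if s: "s \<in> I" for s t
  proof -
    have "((\<lambda>t. L (helicoidal_motion ax h t (\<gamma> s)) + z) has_vector_derivative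
        R t (killing_field ax h (\<gamma> s))) (at t)"
      unfolding R_def has_vector_derivative_add_const by (rule L_deriv, rule helicoidal_motion_derivative)
    then show ?thesis
      by (simp add: partial_t_def X s \<Psi>_eq vector_derivative_at)
  qed
  have V_deriv: "((\<lambda>s. killing_field ax h (\<gamma> s)) has_vector_derivative killing_field ax 0 (\<gamma>' s)) (at s)"
    by (subst killing_field_split, unfold has_vector_derivative_add_const)
      (rule bounded_linear.has_vector_derivative[OF linear_killing_field[unfolded linear_conv_bounded_linear] \<gamma>[OF s]])
  have open_dom: "open (I \<times> (UNIV :: real set))" and dom: "(s, t) \<in> I \<times> UNIV"
    using I s by (simp_all add: open_Times)
  have "(\<lambda>(s, t). N s t) differentiable_on (I \<times> UNIV)"
    using N unfolding unit_normal_field_def by (rule conjunct1)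
  then have N_diff: "(\<lambda>(s, t). N s t) differentiable (at (s, t))"
    using dom unfolding differentiable_on_eq_differentiable_at[OF open_dom] by (rule bspec)
  have N_s: "((\<lambda>x. N x t) has_vector_derivative partial_s N s t) (at s)"
  proof -
    have "(\<lambda>x. (x, t)) differentiable (at s)" by (auto intro!: derivative_intros)
    then have "(\<lambda>x. N x t) differentiable (at s)"
      using differentiable_chain_at[of "\<lambda>x. (x, t)" s "\<lambda>(s, t). N s t"] N_diff by (simp add: o_def)
    then show ?thesis by (simp add: partial_s_def vector_derivative_works)
  qed
  have N_t: "((\<lambda>y. N s y) has_vector_derivative partial_t N s t) (at t)"
  proof -
    have "(\<lambda>y. (s, y)) differentiable (at t)" by (auto intro!: derivative_intros)
    then have "(\<lambda>y. N s y) differentiable (at t)"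
      using differentiable_chain_at[of "\<lambda>y. (s, y)" t "\<lambda>(s, t). N s t"] N_diff by (simp add: o_def)
    then show ?thesis by (simp add: partial_t_def vector_derivative_works)
  qed
  have N_unit: "lorentz (N s t) (N s t) = 1" if "s \<in> I" for s t
    using N that by (auto simp: unit_normal_field_def)
  have N_orth: "lorentz (N s t) (R t (\<gamma>' s)) = 0"
      "lorentz (N s t) (R t (killing_field ax h (\<gamma> s))) = 0" if "s \<in> I" for s t
    using N that by (auto simp: unit_normal_field_def tangent_plane_def X_s X_t intro: span_base)
  have "tangent_plane X s t = span {R t a, R t b}"
    by (simp add: tangent_plane_def X_s X_t s a_def b_def)
  moreover have "dim (tangent_plane X s t) = 2" "nondegenerate_on (tangent_plane X s t)"
    using timelike s by (auto simp: timelike_surface_def)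
  ultimately have "gram_det (R t a) (R t b) \<noteq> 0"
    by (metis gram_det_nonzero)
  then have D: "gram_det a b \<noteq> 0" by (simp add: gram_det_def isoR)
  \<comment> \<open>transport the normal and its derivatives back to the generating curve\<close>
  define pull where "pull = inv (R t)"
  have pull: "R t (pull q) = q" for q
    using lorentz_isometry_bij[OF R] by (simp add: pull_def bij_is_surj surj_f_inv_f)
  have pull_iso: "lorentz (pull q) r = lorentz q (R t r)" "lorentz (pull q) (pull q') = lorentz q q'" for q q' r
    using isoR[of t "pull q" r] isoR[of t "pull q" "pull q'"] by (simp_all add: pull)
  let ?n = "pull (N s t)" and ?p = "pull (partial_s N s t)" and ?q = "pull (partial_t N s t)"
  have n: "lorentz ?n ?n = 1" "lorentz ?n a = 0" "lorentz ?n b = 0"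
    using N_unit[OF s] N_orth[OF s] by (simp_all add: pull_iso pull a_def b_def)
  \<comment> \<open>differentiate \<open>\<langle>N, N\<rangle> = 1\<close> and \<open>\<langle>N, X\<^sub>s\<rangle> = \<langle>N, X\<^sub>t\<rangle> = 0\<close> in \<open>s\<close>, then in \<open>t\<close>\<close>
  have p: "lorentz ?p ?n = 0" "lorentz ?p a = - lorentz ?n u" "lorentz ?p b = - lorentz ?n v"
    using lorentz_product_rule_constant[OF N_s N_s I s N_unit]
      lorentz_product_rule_constant[OF N_s R_deriv[OF \<gamma>'[OF s]] I s N_orth(1)]
      lorentz_product_rule_constant[OF N_s R_deriv[OF V_deriv] I s N_orth(2)]
    by (simp_all add: pull_iso pull a_def b_def u_def v_def lorentz_commute[of "N s t" "partial_s N s t"])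
  have q: "lorentz ?q ?n = 0" "lorentz ?q a = - lorentz ?n v" "lorentz ?q b = - lorentz ?n w"
    using lorentz_product_rule_constant[OF N_t N_t open_UNIV UNIV_I N_unit[OF s]]
      lorentz_product_rule_constant[OF N_t R_deriv_t open_UNIV UNIV_I N_orth(1)[OF s]]
      lorentz_product_rule_constant[OF N_t R_deriv_t open_UNIV UNIV_I N_orth(2)[OF s]]
    by (simp_all add: pull_iso pull a_def b_def v_def w_def lorentz_commute[of "N s t" "partial_t N s t"])
  obtain \<mu> A where \<mu>: "\<mu>^2 * gram_det a b = - 1"
    and A: "\<And>B. (- ?p = B$1$1 *\<^sub>R a + B$2$1 *\<^sub>R b \<and> - ?q = B$1$2 *\<^sub>R a + B$2$2 *\<^sub>R b) \<longleftrightarrow> B = (A::real^2^2)"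
    and tr: "trace A = \<mu> * mean_numerator a b u v w / gram_det a b"
    and det: "det A = \<mu>^2 * gauss_numerator a b u v w / gram_det a b"
    using weingarten_pointwise[OF D n p q] by metis
  have R_comb: "- q = x *\<^sub>R R t a + y *\<^sub>R R t b \<longleftrightarrow> - pull q = x *\<^sub>R a + y *\<^sub>R b" for q x y
  proof -
    have "- q = x *\<^sub>R R t a + y *\<^sub>R R t b \<longleftrightarrow> R t (- pull q) = R t (x *\<^sub>R a + y *\<^sub>R b)"
      by (simp add: pull linear_add[OF linR] linear_cmul[OF linR] linear_neg[OF linR])
    also have "\<dots> \<longleftrightarrow> - pull q = x *\<^sub>R a + y *\<^sub>R b"
      using lorentz_isometry_bij[OF R] by (auto dest: bij_is_inj injD)
    finally show ?thesis .
  qed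
  have "shape_matrix X N s t = A"
    using A by (simp add: shape_matrix_def X_s[OF s] X_t[OF s] a_def[symmetric] b_def[symmetric] R_comb)
  then show thesis
    using that \<mu> tr det by (simp add: mean_curvature_def gauss_curvature_def)
qed

text \<open>
  The unknown scale \<open>\<mu>\<close> of the normal enters only through \<open>\<mu>\<^sup>2 = - 1 / D\<close>, so it disappears from
  \<open>H\<^sup>2 = K\<close> and from \<open>K\<close>; only the sign of \<open>H\<close> depends on it.
\<close>

lemma umbilic_helicoidal_equations:
  fixes \<gamma> \<gamma>' \<gamma>'' :: "real \<Rightarrow> real^3"
  assumes I: "open I"
    and \<gamma>: "\<And>s. s \<in> I \<Longrightarrow> (\<gamma> has_vector_derivative \<gamma>' s) (at s)"
    and \<gamma>': "\<And>s. s \<in> I \<Longrightarrow> (\<gamma>' has_vector_derivative \<gamma>'' s) (at s)"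
    and \<Psi>: "rigid_motion \<Psi>"
    and X: "\<forall>s\<in>I. \<forall>t. X s t = \<Psi> (helicoidal_motion ax h t (\<gamma> s))"
    and timelike: "timelike_surface X (I \<times> UNIV)"
    and N: "unit_normal_field X (I \<times> UNIV) N"
    and umb: "(mean_curvature X N s t)^2 - gauss_curvature X N s t = 0"
    and s: "s \<in> I"
  defines "a \<equiv> \<gamma>' s" and "b \<equiv> killing_field ax h (\<gamma> s)"
  defines "u \<equiv> \<gamma>'' s" and "v \<equiv> killing_field ax 0 a" and "w \<equiv> killing_field ax 0 b"
  shows "gram_det a b < 0"
    "(mean_numerator a b u v w)^2 = 4 * gram_det a b * gauss_numerator a b u v w"
    "gauss_curvature X N s t = - gauss_numerator a b u v w / (gram_det a b)^2"
proof -
  obtain \<mu> where \<mu>: "\<mu>^2 * gram_det a b = - 1"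
    and H: "mean_curvature X N s t = \<mu> * mean_numerator a b u v w / (2 * gram_det a b)"
    and K: "gauss_curvature X N s t = \<mu>^2 * gauss_numerator a b u v w / gram_det a b"
    using helicoidal_curvatures[OF I \<gamma> \<gamma>' \<Psi> X timelike N s, of t]
    unfolding a_def b_def u_def v_def w_def by blast
  show D: "gram_det a b < 0"
    using \<mu> by (metis neg_less_0_iff_less less_numeral_extra(1) mult_nonneg_nonneg not_le zero_le_power2)
  have \<mu>2: "\<mu>^2 = - 1 / gram_det a b" using \<mu> D by (simp add: field_simps)
  show "gauss_curvature X N s t = - gauss_numerator a b u v w / (gram_det a b)^2"
    unfolding K \<mu>2 by (simp add: power2_eq_square)
  have "\<mu>^2 \<noteq> 0" using \<mu> by auto
  moreover have "\<mu>^2 * ((mean_numerator a b u v w)^2 - 4 * gram_det a b * gauss_numerator a b u v w) = 0"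
    using umb D unfolding H K by (simp add: power_divide power_mult_distrib field_simps power2_eq_square)
  ultimately show "(mean_numerator a b u v w)^2 = 4 * gram_det a b * gauss_numerator a b u v w"
    by simp
qed

section \<open>Polynomial solutions of the umbilicity equations\<close>

text \<open>
  An upper bound for the degree together with the coefficient at that bound. The
  coefficient may be zero, so the relation is preserved by sums and products without any
  case distinction on cancellation, and terms of lower order are absorbed with coefficient \<open>0\<close>.
\<close>

definition leading_term :: "real poly \<Rightarrow> nat \<Rightarrow> real \<Rightarrow> bool" where
  "leading_term p n c \<longleftrightarrow> degree p \<le> n \<and> coeff p n = c"

lemma leading_term_unique: "leading_term p n c \<Longrightarrow> leading_term p n d \<Longrightarrow> c = d"
  by (simp add: leading_term_def)

lemma leading_term_cong: "leading_term p n c \<Longrightarrow> n = m \<Longrightarrow> c = d \<Longrightarrow> leading_term p m d"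
  by simp

lemma leading_term_raise: "leading_term p m c \<Longrightarrow> m < n \<Longrightarrow> leading_term p n 0"
  by (auto simp: leading_term_def coeff_eq_0)

lemma leading_term_add: "leading_term p n c \<Longrightarrow> leading_term q n d \<Longrightarrow> leading_term (p + q) n (c + d)"
  by (auto simp: leading_term_def degree_add_le)

lemma leading_term_diff: "leading_term p n c \<Longrightarrow> leading_term q n d \<Longrightarrow> leading_term (p - q) n (c - d)"
  by (auto simp: leading_term_def degree_diff_le)

lemma leading_term_mult:
  assumes "leading_term p m c" "leading_term q n d"
  shows "leading_term (p * q) (m + n) (c * d)"
proof -
  have "coeff (p * q) (m + n) = (\<Sum>i\<le>m + n. coeff p i * coeff q (m + n - i))"
    by (rule coeff_mult)
  also have "\<dots> = (\<Sum>i\<in>{m}. coeff p i * coeff q (m + n - i))"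
  proof (rule sum.mono_neutral_right)
    show "\<forall>i\<in>{..m + n} - {m}. coeff p i * coeff q (m + n - i) = 0"
    proof
      fix i assume i: "i \<in> {..m + n} - {m}"
      then consider "i > m" | "i < m" by force
      then have "coeff p i = 0 \<or> coeff q (m + n - i) = 0"
        using assms by cases (auto simp: leading_term_def coeff_eq_0)
      then show "coeff p i * coeff q (m + n - i) = 0" by simp
    qed
  qed auto
  also have "\<dots> = c * d" using assms by (simp add: leading_term_def)
  finally show ?thesis
    using assms degree_mult_le[of p q] by (simp add: leading_term_def)
qed

lemma leading_term_power2: "leading_term p n c \<Longrightarrow> leading_term (p^2) (n + n) (c * c)"
  by (simp add: power2_eq_square leading_term_mult)

lemma leading_term_const: "leading_term [:c:] 0 c"
  by (simp add: leading_term_def)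

lemma leading_term_one: "leading_term 1 0 1"
  by (simp add: leading_term_def)

lemma leading_term_X: "leading_term [:0, 1:] 1 1"
  by (simp add: leading_term_def)

lemma leading_term_pderiv:
  "leading_term p (Suc n) c \<Longrightarrow> leading_term (pderiv p) n (real (Suc n) * c)"
  by (auto simp: leading_term_def degree_pderiv coeff_pderiv)

lemma leading_terms_of_nonlinear:
  assumes "\<not> degree f \<le> 1"
  obtains k a where "a \<noteq> 0" "leading_term f (k + 2) a"
    "leading_term (pderiv f) (k + 1) (real (k + 2) * a)"
    "leading_term (pderiv (pderiv f)) k (real (k + 1) * (real (k + 2) * a))"
proof -
  obtain k where k: "degree f = k + 2"
    using assms by (metis add.commute le_add_diff_inverse not_less_eq_eq one_add_one plus_1_eq_Suc)
  have 0: "leading_term f (Suc (Suc k)) (lead_coeff f)" using k by (simp add: leading_term_def)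
  note 1 = leading_term_pderiv[OF 0]
  note 2 = leading_term_pderiv[OF 1]
  have "f \<noteq> 0" using k by auto
  then have "lead_coeff f \<noteq> 0" by simp
  then show thesis using that[of "lead_coeff f" k] 0 1 2 by (simp add: algebra_simps)
qed

lemma poly_eq_of_infinite:
  fixes p q :: "real poly"
  assumes "infinite S" "\<And>s. s \<in> S \<Longrightarrow> poly p s = poly q s"
  shows "p = q"
proof (rule ccontr)
  assume "p \<noteq> q"
  then have "finite {s. poly (p - q) s = 0}" by (intro poly_roots_finite) simp
  moreover have "S \<subseteq> {s. poly (p - q) s = 0}" using assms(2) by auto
  ultimately show False using assms(1) finite_subset by blast
qed

lemma degree_le_1_cases:
  fixes f :: "real poly"
  assumes "degree f \<le> 1"
  obtains b c where "f = [:b, c:]"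
proof
  show "f = [:coeff f 0, coeff f 1:]"
    using assms by (intro poly_eqI) (auto simp: coeff_pCons coeff_eq_0 split: nat.split)
qed

text \<open>
  With \<open>f'\<close> of leading term \<open>c s^(k+1)\<close>, the left-hand side is dominated by the square of
  \<open>f'\<^sup>3 s\<^sup>2\<close>, of degree \<open>6 k + 10\<close>, which exceeds the degree \<open>4 k + 8\<close> of the right-hand side.
  For affine \<open>f\<close> the constant coefficients of the identity already determine the slope up to sign.
\<close>

lemma timelike_axis_polynomial:
  fixes f :: "real poly" and h :: real
  defines "X \<equiv> [:0, 1:]" and "f1 \<equiv> pderiv f" and "f2 \<equiv> pderiv (pderiv f)"
  assumes h: "h \<noteq> 0"
    and eq: "((1 - f1^2) * (X^2 * f1) + (X^2 - [:h^2:]) * (X * f2) - [:2 * h^2:] * f1)^2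
      = [:4:] * ((X^2 - [:h^2:] - X^2 * f1^2) * (X^2 * (X * (f1 * f2)) - [:h^2:]))"
  shows "\<exists>a\<^sub>0 \<epsilon>. f = [:a\<^sub>0, \<epsilon>:] \<and> \<epsilon>^2 = 1"
proof -
  have "degree f \<le> 1"
  proof (rule ccontr)
    assume "\<not> degree f \<le> 1"
    then obtain k a where a: "a \<noteq> 0" and f: "leading_term f (k + 2) a"
      and f1: "leading_term f1 (k + 1) (real (k + 2) * a)"
      and f2: "leading_term f2 k (real (k + 1) * (real (k + 2) * a))"
      unfolding f1_def f2_def by (rule leading_terms_of_nonlinear)
    define c where "c = real (k + 2) * a"
    define d where "d = real (k + 1) * (real (k + 2) * a)"
    note f1 = f1[folded c_def] and f2 = f2[folded d_def]
    have c: "c \<noteq> 0" using a by (simp add: c_def)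
    have X: "leading_term X 1 1" unfolding X_def by (rule leading_term_X)
    note X2 = leading_term_power2[OF X] and f1sq = leading_term_power2[OF f1]
    have A: "leading_term ((1 - f1^2) * (X^2 * f1)) (3 * k + 5) (- (c^3))"
      by (rule leading_term_cong[OF leading_term_mult[OF leading_term_diff[OF leading_term_raise[OF leading_term_one] f1sq] leading_term_mult[OF X2 f1]]])
        (simp_all add: algebra_simps power2_eq_square power3_eq_cube)
    have B0: "leading_term (X^2 - [:h^2:]) 2 1"
      by (rule leading_term_cong[OF leading_term_diff[OF X2 leading_term_raise[OF leading_term_const]]])
        (simp_all add: algebra_simps power2_eq_square power3_eq_cube)
    have B: "leading_term ((X^2 - [:h^2:]) * (X * f2)) (3 * k + 5) 0"
      by (rule leading_term_raise[OF leading_term_mult[OF B0 leading_term_mult[OF X f2]]]) simp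
    have C: "leading_term ([:2 * h^2:] * f1) (3 * k + 5) 0"
      by (rule leading_term_raise[OF leading_term_mult[OF leading_term_const f1]]) simp
    have lhs: "leading_term (((1 - f1^2) * (X^2 * f1) + (X^2 - [:h^2:]) * (X * f2) - [:2 * h^2:] * f1)^2)
        (6 * k + 10) ((c^3)^2)"
      by (rule leading_term_cong[OF leading_term_power2[OF leading_term_diff[OF leading_term_add[OF A B] C]]])
        (simp_all add: algebra_simps power2_eq_square power3_eq_cube)
    have D: "leading_term (X^2 - [:h^2:] - X^2 * f1^2) (2 * k + 4) (- (c^2))"
      by (rule leading_term_cong[OF leading_term_diff[OF leading_term_raise[OF B0] leading_term_mult[OF X2 f1sq]]])
        (simp_all add: algebra_simps power2_eq_square power3_eq_cube)
    have E: "leading_term (X^2 * (X * (f1 * f2)) - [:h^2:]) (2 * k + 4) (c * d)"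
      by (rule leading_term_cong[OF leading_term_diff[OF leading_term_mult[OF X2 leading_term_mult[OF X leading_term_mult[OF f1 f2]]] leading_term_raise[OF leading_term_const]]])
        (simp_all add: algebra_simps power2_eq_square power3_eq_cube)
    have "leading_term ([:4:] * ((X^2 - [:h^2:] - X^2 * f1^2) * (X^2 * (X * (f1 * f2)) - [:h^2:]))) (6 * k + 10) 0"
      by (rule leading_term_raise[OF leading_term_mult[OF leading_term_const leading_term_mult[OF D E]]]) simp
    then have "(c^3)^2 = 0" using lhs unfolding eq by (rule leading_term_unique[rotated])
    then show False using c by simp
  qed
  then obtain b c where f: "f = [:b, c:]"
    by (rule degree_le_1_cases)
  then have "f1 = [:c:]" "f2 = 0" by (simp_all add: f1_def f2_def pderiv_pCons)
  then have "(c * (2 * h^2))^2 = h^2 * 4 * h^2"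
    using arg_cong[OF eq, of "\<lambda>p. poly p 0"] by (simp add: X_def mult_ac)
  then have "c^2 = 1" using h by (simp add: power_mult_distrib power2_eq_square)
  with f show ?thesis by blast
qed

text \<open>
  Here the right-hand side dominates: \<open>(f f')\<^sup>2 f'\<^sup>4\<close> has degree \<open>8 k + 10\<close>, the left-hand side at most
  \<open>6 k + 8\<close>. For affine \<open>f\<close> of slope \<open>c\<close>, the identity has the factor \<open>(1 - c\<^sup>2)\<^sup>2\<close>; after cancelling
  it, the left-hand side is constant and the right-hand side is not.
\<close>

lemma spacelike_axis_polynomial:
  fixes f :: "real poly" and h :: real
  defines "X \<equiv> [:0, 1:]" and "f1 \<equiv> pderiv f" and "f2 \<equiv> pderiv (pderiv f)"
  assumes eq: "((1 - f1^2) * (f - X * f1) - ([:h^2:] + f^2 - X^2) * f2)^2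
      = [:4:] * (([:h^2:] * (1 - f1^2) - (X - f * f1)^2) * (f2 * (f - X * f1) - (1 - f1^2)^2))"
  shows "\<exists>a\<^sub>0 \<epsilon>. f = [:a\<^sub>0, \<epsilon>:] \<and> \<epsilon>^2 = 1"
proof -
  have "degree f \<le> 1"
  proof (rule ccontr)
    assume "\<not> degree f \<le> 1"
    then obtain k a where a: "a \<noteq> 0" and f: "leading_term f (k + 2) a"
      and f1: "leading_term f1 (k + 1) (real (k + 2) * a)"
      and f2: "leading_term f2 k (real (k + 1) * (real (k + 2) * a))"
      unfolding f1_def f2_def by (rule leading_terms_of_nonlinear)
    define c where "c = real (k + 2) * a"
    define d where "d = real (k + 1) * (real (k + 2) * a)"
    note f1 = f1[folded c_def] and f2 = f2[folded d_def]
    have c: "c \<noteq> 0" using a by (simp add: c_def)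
    have X: "leading_term X 1 1" unfolding X_def by (rule leading_term_X)
    note X2 = leading_term_power2[OF X] and f1sq = leading_term_power2[OF f1]
    have A: "leading_term (1 - f1^2) (2 * k + 2) (- (c^2))"
      by (rule leading_term_cong[OF leading_term_diff[OF leading_term_raise[OF leading_term_one] f1sq]])
        (simp_all add: algebra_simps power2_eq_square power3_eq_cube)
    have B: "leading_term (f - X * f1) (k + 2) (a - c)"
      by (rule leading_term_cong[OF leading_term_diff[OF leading_term_cong[OF f _ refl] leading_term_mult[OF X f1]]])
        (simp_all add: algebra_simps power2_eq_square power3_eq_cube)
    have C: "leading_term ([:h^2:] + f^2 - X^2) (2 * k + 4) (a^2)"
      by (rule leading_term_cong[OF leading_term_diff[OF leading_term_add[OF leading_term_raise[OF leading_term_const] leading_term_power2[OF f]] leading_term_raise[OF X2]]])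
        (simp_all add: algebra_simps power2_eq_square power3_eq_cube)
    have lhs1: "leading_term ((1 - f1^2) * (f - X * f1) - ([:h^2:] + f^2 - X^2) * f2)
        (3 * k + 4) (- (c^2) * (a - c) - a^2 * d)"
      by (rule leading_term_cong[OF leading_term_diff[OF leading_term_cong[OF leading_term_mult[OF A B] _ refl] leading_term_mult[OF C f2]]])
        (simp_all add: algebra_simps power2_eq_square power3_eq_cube)
    have lhs: "leading_term (((1 - f1^2) * (f - X * f1) - ([:h^2:] + f^2 - X^2) * f2)^2) (8 * k + 10) 0"
      by (rule leading_term_raise[OF leading_term_power2[OF lhs1]]) simp
    have "leading_term (X - f * f1) (2 * k + 3) (- (a * c))"
      by (rule leading_term_cong[OF leading_term_diff[OF leading_term_raise[OF X] leading_term_mult[OF f f1]]])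
        (simp_all add: algebra_simps power2_eq_square power3_eq_cube)
    note D0 = leading_term_power2[OF this]
    have D: "leading_term ([:h^2:] * (1 - f1^2) - (X - f * f1)^2) (4 * k + 6) (- ((a * c)^2))"
      by (rule leading_term_cong[OF leading_term_diff[OF leading_term_raise[OF leading_term_mult[OF leading_term_const A]] D0]])
        (simp_all add: algebra_simps power2_eq_square power3_eq_cube)
    have E: "leading_term (f2 * (f - X * f1) - (1 - f1^2)^2) (4 * k + 4) (- ((c^2)^2))"
      by (rule leading_term_cong[OF leading_term_diff[OF leading_term_raise[OF leading_term_mult[OF f2 B]] leading_term_power2[OF A]]])
        (simp_all add: algebra_simps power2_eq_square power3_eq_cube)
    have "leading_term ([:4:] * (([:h^2:] * (1 - f1^2) - (X - f * f1)^2) * (f2 * (f - X * f1) - (1 - f1^2)^2)))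
        (8 * k + 10) (4 * ((a * c)^2 * (c^2)^2))"
      by (rule leading_term_cong[OF leading_term_mult[OF leading_term_const[of 4] leading_term_mult[OF D E]]])
        (simp_all add: algebra_simps power2_eq_square power3_eq_cube)
    then have "4 * ((a * c)^2 * (c^2)^2) = 0" using lhs unfolding eq by (rule leading_term_unique)
    then show False using a c by simp
  qed
  then obtain b c where f: "f = [:b, c:]"
    by (rule degree_le_1_cases)
  then have f12: "f1 = [:c:]" "f2 = 0" by (simp_all add: f1_def f2_def pderiv_pCons)
  define e where "e = 1 - c^2"
  have "e = 0"
  proof (rule ccontr)
    assume e: "e \<noteq> 0"
    have all: "b^2 = 4 * ((e * s - c * b)^2 - h^2 * e)" for s
    proof -
      have "(e * b)^2 = 4 * ((h^2 * e - (e * s - c * b)^2) * (- (e^2)))"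
        using arg_cong[OF eq, of "\<lambda>p. poly p s"]
        by (simp add: X_def f f12 e_def algebra_simps power2_eq_square)
      then have "e^2 * b^2 = e^2 * (4 * ((e * s - c * b)^2 - h^2 * e))"
        by (simp add: algebra_simps power2_eq_square)
      then show ?thesis using e by simp
    qed
    \<comment> \<open>at these two arguments \<open>e * s - c * b\<close> is \<open>0\<close> and \<open>1\<close>\<close>
    show False using all[of "c * b / e"] all[of "(c * b + 1) / e"] e by simp
  qed
  then have "c^2 = 1" by (simp add: e_def)
  with f show ?thesis by blast
qed

text \<open>
  For degree \<open>k + 2\<close> the term \<open>f'\<^sup>3 f''\<close> on the right has degree \<open>4 k + 3\<close>, beyond the degree
  \<open>2 k + 2\<close> of the left-hand side. For affine \<open>f\<close> the left-hand side is constant but the right-hand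
  side has slope \<open>4\<close>.
\<close>

lemma lightlike_axis_polynomial:
  fixes f :: "real poly" and h :: real
  defines "X \<equiv> [:0, 1:]" and "f1 \<equiv> pderiv f" and "f2 \<equiv> pderiv (pderiv f)"
  assumes h: "h \<noteq> 0"
  shows "[:h:] * (f1 - [:2:] * (X * f2))^2 \<noteq> [:4:] * ((X + [:h:] * f1^2) * (1 + [:2 * h:] * (f1 * f2)))"
proof
  assume eq: "[:h:] * (f1 - [:2:] * (X * f2))^2 = [:4:] * ((X + [:h:] * f1^2) * (1 + [:2 * h:] * (f1 * f2)))"
  have "degree f \<le> 1"
  proof (rule ccontr)
    assume "\<not> degree f \<le> 1"
    then obtain k a where a: "a \<noteq> 0" and f: "leading_term f (k + 2) a"
      and f1: "leading_term f1 (k + 1) (real (k + 2) * a)"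
      and f2: "leading_term f2 k (real (k + 1) * (real (k + 2) * a))"
      unfolding f1_def f2_def by (rule leading_terms_of_nonlinear)
    define c where "c = real (k + 2) * a"
    define d where "d = real (k + 1) * (real (k + 2) * a)"
    note f1 = f1[folded c_def] and f2 = f2[folded d_def]
    have c: "c \<noteq> 0" and d: "d \<noteq> 0" using a by (simp_all add: c_def d_def)
    have X: "leading_term X 1 1" unfolding X_def by (rule leading_term_X)
    have "leading_term (f1 - [:2:] * (X * f2)) (k + 1) (c - 2 * d)"
      by (rule leading_term_cong[OF leading_term_diff[OF leading_term_cong[OF f1 _ refl] leading_term_mult[OF leading_term_const[of 2] leading_term_mult[OF X f2]]]])
        (simp_all add: algebra_simps power2_eq_square power3_eq_cube)
    note A = leading_term_mult[OF leading_term_const[of h] leading_term_power2[OF this]]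
    have lhs: "leading_term ([:h:] * (f1 - [:2:] * (X * f2))^2) (4 * k + 3) 0"
      by (rule leading_term_raise[OF A]) simp
    have D: "leading_term (X + [:h:] * f1^2) (2 * k + 2) (h * c^2)"
      by (rule leading_term_cong[OF leading_term_add[OF leading_term_raise[OF X] leading_term_mult[OF leading_term_const[of h] leading_term_power2[OF f1]]]])
        (simp_all add: algebra_simps power2_eq_square power3_eq_cube)
    have E: "leading_term (1 + [:2 * h:] * (f1 * f2)) (2 * k + 1) (2 * h * (c * d))"
      by (rule leading_term_cong[OF leading_term_add[OF leading_term_raise[OF leading_term_one] leading_term_mult[OF leading_term_const[of "2 * h"] leading_term_mult[OF f1 f2]]]])
        (simp_all add: algebra_simps power2_eq_square power3_eq_cube)
    have "leading_term ([:4:] * ((X + [:h:] * f1^2) * (1 + [:2 * h:] * (f1 * f2)))) (4 * k + 3)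
        (4 * ((h * c^2) * (2 * h * (c * d))))"
      by (rule leading_term_cong[OF leading_term_mult[OF leading_term_const[of 4] leading_term_mult[OF D E]]])
        (simp_all add: algebra_simps power2_eq_square power3_eq_cube)
    then have "4 * ((h * c^2) * (2 * h * (c * d))) = 0" using lhs unfolding eq by (rule leading_term_unique)
    then show False using h c d by simp
  qed
  then obtain b c where "f = [:b, c:]"
    by (rule degree_le_1_cases)
  then have "f1 = [:c:]" "f2 = 0" by (simp_all add: f1_def f2_def pderiv_pCons)
  then have at: "h * c^2 = 4 * (s + h * c^2)" for s
    using arg_cong[OF eq, of "\<lambda>p. poly p s"] by (simp add: X_def)
  have "h * c^2 = 0" using at[of 0] by simp
  with at[of 1] show False by (simp only: add_0_right)
qed

section \<open>The fundamental forms for graphs and lines\<close>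

text \<open>
  Both kinds of profile are curves in the same coordinate plane of the axis, so their derivatives
  are obtained coordinatewise from one parametrization of that plane.
\<close>

fun generating_plane :: "axis \<Rightarrow> real \<Rightarrow> real \<Rightarrow> real^3" where
  "generating_plane Timelike_axis x z = vector [x, 0, z]"
| "generating_plane Spacelike_axis x z = vector [0, x, z]"
| "generating_plane Lightlike_axis x z = vector [z, x, z]"

lemma generating_curve_Graph: "generating_curve ax (Graph f) s = generating_plane ax s (poly f s)"
  by (cases ax) simp_all

lemma generating_curve_Line: "generating_curve ax (Line r) s = generating_plane ax r s"
  by (cases ax) simp_all

lemma generating_plane_derivative:
  assumes "(x has_real_derivative x') (at s)" "(z has_real_derivative z') (at s)"
  shows "((\<lambda>s. generating_plane ax (x s) (z s)) has_vector_derivative generating_plane ax x' z') (at s)"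
  using assms by (cases ax) (auto intro!: has_vector_derivative_vector3)

text \<open>
  In this and the following two lemmas \<open>y, y1, y2\<close> stand for \<open>f(s), f'(s), f''(s)\<close>; they turn
  the equation \<open>P\<^sup>2 = 4 D Q\<close> into the identities solved by the polynomial lemmas above.
\<close>

lemma timelike_graph_forms:
  fixes h s y y1 y2 :: real
  defines "a \<equiv> generating_plane Timelike_axis 1 y1"
    and "b \<equiv> killing_field Timelike_axis h (generating_plane Timelike_axis s y)"
    and "u \<equiv> generating_plane Timelike_axis 0 y2"
  defines "v \<equiv> killing_field Timelike_axis 0 a" and "w \<equiv> killing_field Timelike_axis 0 b"
  shows "gram_det a b = s^2 - h^2 - s^2 * y1^2"
    "mean_numerator a b u v w = (1 - y1^2) * (s^2 * y1) + (s^2 - h^2) * (s * y2) - 2 * h^2 * y1"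
    "gauss_numerator a b u v w = s^2 * (s * (y1 * y2)) - h^2"
  unfolding a_def b_def u_def v_def w_def gram_det_def mean_numerator_def gauss_numerator_def
    lorentz_def lorentz_cross_def generating_plane.simps killing_field.simps vector_3
  by algebra+

lemma spacelike_graph_forms:
  fixes h s y y1 y2 :: real
  defines "a \<equiv> generating_plane Spacelike_axis 1 y1"
    and "b \<equiv> killing_field Spacelike_axis h (generating_plane Spacelike_axis s y)"
    and "u \<equiv> generating_plane Spacelike_axis 0 y2"
  defines "v \<equiv> killing_field Spacelike_axis 0 a" and "w \<equiv> killing_field Spacelike_axis 0 b"
  shows "gram_det a b = h^2 * (1 - y1^2) - (s - y * y1)^2"
    "mean_numerator a b u v w = h * ((1 - y1^2) * (y - s * y1) - (h^2 + y^2 - s^2) * y2)"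
    "gauss_numerator a b u v w = h^2 * (y2 * (y - s * y1) - (1 - y1^2)^2)"
  unfolding a_def b_def u_def v_def w_def gram_det_def mean_numerator_def gauss_numerator_def
    lorentz_def lorentz_cross_def generating_plane.simps killing_field.simps vector_3
  by algebra+

lemma lightlike_graph_forms:
  fixes h s y y1 y2 :: real
  defines "a \<equiv> generating_plane Lightlike_axis 1 y1"
    and "b \<equiv> killing_field Lightlike_axis h (generating_plane Lightlike_axis s y)"
    and "u \<equiv> generating_plane Lightlike_axis 0 y2"
  defines "v \<equiv> killing_field Lightlike_axis 0 a" and "w \<equiv> killing_field Lightlike_axis 0 b"
  shows "gram_det a b = - 4 * h * (s + h * y1^2)"
    "mean_numerator a b u v w = 4 * h^2 * (y1 - 2 * (s * y2))"
    "gauss_numerator a b u v w = - 4 * h^2 * (1 + 2 * h * (y1 * y2))"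
  unfolding a_def b_def u_def v_def w_def gram_det_def mean_numerator_def gauss_numerator_def
    lorentz_def lorentz_cross_def generating_plane.simps killing_field.simps vector_3
  by algebra+

lemma line_forms:
  fixes h s r :: real
  defines "a \<equiv> \<lambda>ax. generating_plane ax 0 1"
    and "b \<equiv> \<lambda>ax. killing_field ax h (generating_plane ax r s)"
    and "u \<equiv> \<lambda>ax. generating_plane ax 0 0"
  defines "v \<equiv> \<lambda>ax. killing_field ax 0 (a ax)" and "w \<equiv> \<lambda>ax. killing_field ax 0 (b ax)"
  defines "D \<equiv> \<lambda>ax. gram_det (a ax) (b ax)"
    and "P \<equiv> \<lambda>ax. mean_numerator (a ax) (b ax) (u ax) (v ax) (w ax)"
    and "Q \<equiv> \<lambda>ax. gauss_numerator (a ax) (b ax) (u ax) (v ax) (w ax)"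
  shows "P Timelike_axis = - (r^2)" "Q Timelike_axis = 0"
    "D Spacelike_axis = - (h^2 + s^2)" "P Spacelike_axis = h * r" "Q Spacelike_axis = - (h^2)"
    "Q Lightlike_axis = 0"
  unfolding a_def b_def u_def v_def w_def D_def P_def Q_def
    gram_det_def mean_numerator_def gauss_numerator_def
    lorentz_def lorentz_cross_def generating_plane.simps killing_field.simps vector_3
  by (simp_all add: algebra_simps power2_eq_square)

section \<open>Classification\<close>

theorem theorem4p1:
  fixes ax :: axis and h :: real and c :: profile and I :: "real set"
    and \<Psi> :: "real^3 \<Rightarrow> real^3" and X N :: "real \<Rightarrow> real \<Rightarrow> real^3"
  assumes "h \<noteq> 0"
    and "open I" and "is_interval I" and "I \<noteq> {}"
    and "rigid_motion \<Psi>"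
    and "admissible_profile ax c"
    and "\<forall>s\<in>I. \<forall>t. X s t = \<Psi> (helicoidal_motion ax h t (generating_curve ax c s))"
    and "timelike_surface X (I \<times> UNIV)"
    and "unit_normal_field X (I \<times> UNIV) N"
    and "\<forall>s\<in>I. \<forall>t. (mean_curvature X N s t)^2 - gauss_curvature X N s t = 0"
  shows "profile_degree c \<le> 1 \<and>
    (ax = Timelike_axis \<longrightarrow>
      (\<exists>a\<^sub>0 \<epsilon>. \<epsilon> \<in> {1, -1} \<and>
        (\<forall>s\<in>I. \<forall>t. X s t = \<Psi> (vector [s * cos t, s * sin t, \<epsilon> * s + a\<^sub>0 + h * t]) \<and>
           \<bar>mean_curvature X N s t\<bar> = 1 / \<bar>h\<bar> \<and> gauss_curvature X N s t = 1 / h^2))) \<and>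
    (ax = Spacelike_axis \<longrightarrow>
      (\<exists>a\<^sub>0 \<epsilon>. \<epsilon> \<in> {1, -1} \<and> a\<^sub>0 \<noteq> 0 \<and>
        (\<forall>s\<in>I. \<forall>t. X s t = \<Psi> (vector [h * t,
             (\<epsilon> * s + a\<^sub>0) * sinh t + s * cosh t,
             (\<epsilon> * s + a\<^sub>0) * cosh t + s * sinh t]) \<and>
           mean_curvature X N s t = 0 \<and> gauss_curvature X N s t = 0))) \<and>
    (ax = Lightlike_axis \<longrightarrow>
      (\<exists>b. (\<forall>s\<in>I. \<forall>t. X s t = \<Psi> (vector [s + b * t + h * (- t + t^3/3),
             b + h * t^2,
             s + b * t + h * (t + t^3/3)]) \<and>
           mean_curvature X N s t = 0 \<and> gauss_curvature X N s t = 0)))"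
proof -
  note h = \<open>h \<noteq> 0\<close> and I = \<open>open I\<close>
  have X: "X s t = \<Psi> (helicoidal_motion ax h t (generating_curve ax c s))" if "s \<in> I" for s t
    using assms(7) that by blast
  have umb: "(mean_curvature X N s t)^2 - gauss_curvature X N s t = 0" if "s \<in> I" for s t
    using assms(10) that by blast
  obtain s\<^sub>0 where s\<^sub>0: "s\<^sub>0 \<in> I" using \<open>I \<noteq> {}\<close> by blast
  have inf: "infinite I"
    using I s\<^sub>0 islimpt_UNIV[of s\<^sub>0] finite_imp_not_open[of I] by auto
  have H0: "mean_curvature X N s t = 0" if "s \<in> I" "gauss_curvature X N s t = 0" for s t
    using umb[OF that(1), of t] that(2) by simp
  have poly_const: "poly [:a:] s = a" and poly_X: "poly [:0, 1:] s = s" for a s :: real by simp_all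
  note poly_at = poly_mult poly_add poly_diff poly_power poly_1 poly_const poly_X
  show ?thesis
  proof (cases c)
    case (Graph f)
    let ?g = "\<lambda>s. generating_plane ax s (poly f s)"
      and ?g1 = "\<lambda>s. generating_plane ax 1 (poly (pderiv f) s)"
      and ?g2 = "\<lambda>s. generating_plane ax 0 (poly (pderiv (pderiv f)) s)"
    have X': "\<forall>s\<in>I. \<forall>t. X s t = \<Psi> (helicoidal_motion ax h t (?g s))"
      using X by (simp add: Graph generating_curve_Graph)
    have d: "(?g has_vector_derivative ?g1 s) (at s)" "(?g1 has_vector_derivative ?g2 s) (at s)" for s
      by (rule generating_plane_derivative; auto intro!: derivative_eq_intros poly_DERIV)+
    note U = umbilic_helicoidal_equations[OF I d assms(5) X' assms(8,9) umb]
    show ?thesis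
    proof (cases ax)
      case Timelike_axis
      note U = U[unfolded Timelike_axis timelike_graph_forms]
      have "\<exists>a\<^sub>0 \<epsilon>. f = [:a\<^sub>0, \<epsilon>:] \<and> \<epsilon>^2 = 1"
      proof (rule timelike_axis_polynomial[OF h], rule poly_eq_of_infinite[OF inf])
        fix s assume s: "s \<in> I"
        show "poly (((1 - (pderiv f)^2) * ([:0, 1:]^2 * pderiv f) + ([:0, 1:]^2 - [:h^2:]) * ([:0, 1:] * pderiv (pderiv f))
              - [:2 * h^2:] * pderiv f)^2) s
          = poly ([:4:] * (([:0, 1:]^2 - [:h^2:] - [:0, 1:]^2 * (pderiv f)^2)
              * ([:0, 1:]^2 * ([:0, 1:] * (pderiv f * pderiv (pderiv f))) - [:h^2:]))) s"
          using U(2)[OF s s] unfolding poly_at by (simp only: mult.assoc)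
      qed
      then obtain a\<^sub>0 \<epsilon> where f: "f = [:a\<^sub>0, \<epsilon>:]" and \<epsilon>: "\<epsilon>^2 = 1" by blast
      have \<epsilon>': "\<epsilon> \<in> {1, -1}" using \<epsilon> by (simp add: power2_eq_1_iff)
      have K: "gauss_curvature X N s t = 1 / h^2" if "s \<in> I" for s t
      proof -
        have "gauss_curvature X N s t = h^2 / (h^2)^2"
          using U(3)[OF that that, of t] by (simp add: f pderiv_pCons \<epsilon>)
        then show ?thesis using h by (simp add: power2_eq_square)
      qed
      have H: "\<bar>mean_curvature X N s t\<bar> = 1 / \<bar>h\<bar>" if "s \<in> I" for s t
      proof -
        have "(mean_curvature X N s t)^2 = (1 / h)^2"
          using umb[OF that, of t] K[OF that, of t] by (simp add: power_divide)
        then show ?thesis by (auto simp: power2_eq_iff)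
      qed
      have X'': "X s t = \<Psi> (vector [s * cos t, s * sin t, \<epsilon> * s + a\<^sub>0 + h * t])" if "s \<in> I" for s t
        using X[OF that] by (simp add: Graph Timelike_axis f vector_3 algebra_simps)
      show ?thesis
        unfolding Graph Timelike_axis
        by (intro conjI impI, simp add: f, rule exI[of _ a\<^sub>0], rule exI[of _ \<epsilon>], insert \<epsilon>' K H X'', simp_all)
    next
      case Spacelike_axis
      note U = U[unfolded Spacelike_axis spacelike_graph_forms]
      have "\<exists>a\<^sub>0 \<epsilon>. f = [:a\<^sub>0, \<epsilon>:] \<and> \<epsilon>^2 = 1"
      proof (rule spacelike_axis_polynomial[of f h], rule poly_eq_of_infinite[OF inf])
        fix s assume s: "s \<in> I"
        show "poly (((1 - (pderiv f)^2) * (f - [:0, 1:] * pderiv f) - ([:h^2:] + f^2 - [:0, 1:]^2) * pderiv (pderiv f))^2) s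
          = poly ([:4:] * (([:h^2:] * (1 - (pderiv f)^2) - ([:0, 1:] - f * pderiv f)^2)
              * (pderiv (pderiv f) * (f - [:0, 1:] * pderiv f) - (1 - (pderiv f)^2)^2))) s"
          using U(2)[OF s s] h unfolding poly_at by (simp add: power_mult_distrib)
      qed
      then obtain a\<^sub>0 \<epsilon> where f: "f = [:a\<^sub>0, \<epsilon>:]" and \<epsilon>: "\<epsilon>^2 = 1" by blast
      have \<epsilon>': "\<epsilon> \<in> {1, -1}" using \<epsilon> by (simp add: power2_eq_1_iff)
      have f1: "pderiv f = [:\<epsilon>:]" by (simp add: f pderiv_pCons)
      have K: "gauss_curvature X N s t = 0" if "s \<in> I" for s t
        using U(3)[OF that that, of t] by (simp add: f1 \<epsilon>)
      \<comment> \<open>for slope \<open>\<plusminus>1\<close> the discriminant is \<open>- a\<^sub>0\<^sup>2\<close>, so the surface is degenerate unless \<open>a\<^sub>0 \<noteq> 0\<close>\<close>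
      have "0 < (s\<^sub>0 - poly f s\<^sub>0 * \<epsilon>)^2"
        using U(1)[OF s\<^sub>0 s\<^sub>0] by (simp add: f1 \<epsilon>)
      moreover have "s\<^sub>0 - poly f s\<^sub>0 * \<epsilon> = - (a\<^sub>0 * \<epsilon>)"
        using \<epsilon> by (simp add: f) algebra
      ultimately have a\<^sub>0: "a\<^sub>0 \<noteq> 0" by auto
      have X'': "X s t = \<Psi> (vector [h * t, (\<epsilon> * s + a\<^sub>0) * sinh t + s * cosh t,
          (\<epsilon> * s + a\<^sub>0) * cosh t + s * sinh t])" if "s \<in> I" for s t
        using X[OF that] by (simp add: Graph Spacelike_axis f vector_3 algebra_simps)
      show ?thesis
        unfolding Graph Spacelike_axis
        by (intro conjI impI, simp add: f, simp, rule exI[of _ a\<^sub>0], rule exI[of _ \<epsilon>], insert \<epsilon>' a\<^sub>0 K H0 X'', simp_all)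
    next
      case Lightlike_axis
      note U = U[unfolded Lightlike_axis lightlike_graph_forms]
      define X0 :: "real poly" where "X0 = [:0, 1:]"
      have "[:h:] * (pderiv f - [:2:] * (X0 * pderiv (pderiv f)))^2
        = [:4:] * ((X0 + [:h:] * (pderiv f)^2) * (1 + [:2 * h:] * (pderiv f * pderiv (pderiv f))))"
      proof (rule poly_eq_of_infinite[OF inf])
        fix s assume s: "s \<in> I"
        let ?y1 = "poly (pderiv f) s" and ?y2 = "poly (pderiv (pderiv f)) s"
        have "(4 * h^2 * (?y1 - 2 * (s * ?y2)))^2 = 
            4 * (- 4 * h * (s + h * ?y1^2)) * (- 4 * h^2 * (1 + 2 * h * (?y1 * ?y2)))"
          using U(2)[OF s s] .
        \<comment> \<open>both sides carry the nonzero factor \<open>16 h\<^sup>3\<close>\<close>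
        then have "16 * h^3 * (h * (?y1 - 2 * (s * ?y2))^2) = 16 * h^3 * (4 * ((s + h * ?y1^2) * (1 + 2 * h * (?y1 * ?y2))))"
          by algebra
        then show "poly ([:h:] * (pderiv f - [:2:] * (X0 * pderiv (pderiv f)))^2) s
          = poly ([:4:] * ((X0 + [:h:] * (pderiv f)^2) * (1 + [:2 * h:] * (pderiv f * pderiv (pderiv f))))) s"
          using h unfolding X0_def poly_at by simp
      qed
      \<comment> \<open>no graph is possible\<close>
      then show ?thesis using lightlike_axis_polynomial[OF h, of f] by (simp add: X0_def)
    qed
  next
    case (Line r)
    let ?g = "\<lambda>s. generating_plane ax r s"
      and ?g1 = "\<lambda>s::real. generating_plane ax 0 1"
      and ?g2 = "\<lambda>s::real. generating_plane ax 0 0"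
    have X': "\<forall>s\<in>I. \<forall>t. X s t = \<Psi> (helicoidal_motion ax h t (?g s))"
      using X by (simp add: Line generating_curve_Line)
    have d: "(?g has_vector_derivative ?g1 s) (at s)" "(?g1 has_vector_derivative ?g2 s) (at s)" for s
      by (rule generating_plane_derivative; auto intro!: derivative_eq_intros)+
    note U = umbilic_helicoidal_equations[OF I d assms(5) X' assms(8,9) umb]
    show ?thesis
    proof (cases ax)
      case Timelike_axis
      \<comment> \<open>the circular cylinder has \<open>Q = 0\<close> but \<open>P \<noteq> 0\<close>\<close>
      have "r > 0" using assms(6) by (simp add: Timelike_axis Line)
      then show ?thesis using U(2)[OF s\<^sub>0 s\<^sub>0, unfolded Timelike_axis line_forms] by simp
    next
      case Spacelike_axis
      have "h^2 * (r^2 - 4 * (h^2 + s^2)) = 0" if "s \<in> I" for s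
        using U(2)[OF that that, unfolded Spacelike_axis line_forms] by (simp add: algebra_simps power2_eq_square)
      then have "r^2 = 4 * (h^2 + s^2)" if "s \<in> I" for s
        using h that by force
      then have "[:r^2:] = [:4 * h^2, 0, 4:]"
        by (intro poly_eq_of_infinite[OF inf]) (simp add: algebra_simps power2_eq_square)
      then show ?thesis by simp
    next
      case Lightlike_axis
      have K: "gauss_curvature X N s t = 0" if "s \<in> I" for s t
        using U(3)[OF that that, of t, unfolded Lightlike_axis line_forms] by simp
      have "X s t = \<Psi> (vector [s + r * t + h * (- t + t^3/3), r + h * t^2, s + r * t + h * (t + t^3/3)])"
        if "s \<in> I" for s t
      proof -
        have "helicoidal_motion ax h t (generating_curve ax c s) =
            vector [s + r * t + h * (- t + t^3/3), r + h * t^2, s + r * t + h * (t + t^3/3)]"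
          by (simp add: Line Lightlike_axis vec_eq_iff forall_3 vector_3 algebra_simps)
        then show ?thesis using X[OF that] by simp
      qed
      then show ?thesis
        using K H0 by (auto simp: Line Lightlike_axis intro!: exI[of _ r])
    qed
  qed
qed

end
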